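(* Assume Vopěnka's Principle. Let $\mathcal{K}$ be a cocomplete category which has both a colimit-dense subcategory and a presentable generator. Then $\mathcal{K}$ is bounded, i.e. $\mathcal{K}$ has a dense subcategory.
   Context: Vopěnka's Principle is the set-theoretic statement that there is no rigid proper class of graphs; a graph is a set with a binary relation, and a class of graphs is rigid if the only homomorphisms between its members are the identity endomorphisms. A small, full subcategory $\mathcal{G}$ of a category $\mathcal{K}$ is called dense if every object $X$ of $\mathcal{K}$ is the canonical colimit of objects of $\mathcal{G}$: the diagram $D_X:\mathcal{G}/X\to\mathcal{K}$ assigning to every object $g:G\to X$ (with $G\in\mathcal{G}$) its domain $G$ has colimit $X$, with the canonical colimit cocone (whose component at $g$ is $g$). A category is called bounded if it has a dense subcategory. A small, full subcategory $\mathcal{G}$ of $\mathcal{K}$ is called colimit-dense if every object of $\mathcal{K}$ is a colimit of some diagram in $\mathcal{G}$. An object $K$ of $\mathcal{K}$ is presentable if its hom-functor $\mathcal{K}(K,-)$ preserves $\lambda$-filtered colimits for some regular cardinal $\lambda$. A generator of $\mathcal{K}$ is a set of objects whose hom-functors are collectively faithful (it is considered as a full subcategory). A generator is presentable if all of its objects are presentable. *)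

theory Defs
  imports "HOL-Library.FuncSet"
begin

unbundle cardinal_syntax

section \<open>Sets and classes\<close>

text \<open>
  Vopenka's Principle needs the distinction between sets and proper classes. The type
  \<open>'v\<close> plays the role of the class of all sets: a class is a subset of \<open>'v\<close>, and
  by von Neumann's limitation of size a class is a set iff it is strictly smaller than
  the universe. The ZFC axioms then amount to the cardinality of \<open>'v\<close> being
  strongly inaccessible: uncountable (infinity), regular (replacement and union) and a
  strong limit (power set).
\<close>

definition set_universe :: "'v itself \<Rightarrow> bool" where
  "set_universe V \<longleftrightarrow>
     natLeq <o |UNIV :: 'v set| \<and>
     regularCard |UNIV :: 'v set| \<and>
     (\<forall>A :: 'v set. |A| <o |UNIV :: 'v set| \<longrightarrow> |Pow A| <o |UNIV :: 'v set| )"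

text \<open>
  \<open>A\<close> may live in a type other than \<open>'v\<close>, e.g. for classes whose members are graphs.
\<close>

definition small :: "'v itself \<Rightarrow> 'a set \<Rightarrow> bool" where
  "small V A \<longleftrightarrow> |A| <o |UNIV :: 'v set|"

section \<open>Vopenka's Principle\<close>

type_synonym 'v graph = "'v set \<times> ('v \<times> 'v) set"

definition is_graph :: "'v graph \<Rightarrow> bool" where
  "is_graph G \<longleftrightarrow> small TYPE('v) (fst G) \<and> snd G \<subseteq> fst G \<times> fst G"

definition graph_hom :: "'v graph \<Rightarrow> 'v graph \<Rightarrow> ('v \<Rightarrow> 'v) \<Rightarrow> bool" where
  "graph_hom G H f \<longleftrightarrow>
     f \<in> fst G \<rightarrow> fst H \<and> (\<forall>x y. (x, y) \<in> snd G \<longrightarrow> (f x, f y) \<in> snd H)"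

definition rigid :: "'v graph set \<Rightarrow> bool" where
  "rigid \<C> \<longleftrightarrow>
     (\<forall>G\<in>\<C>. \<forall>H\<in>\<C>. \<forall>f. graph_hom G H f \<longrightarrow> G = H \<and> (\<forall>x\<in>fst G. f x = x))"

definition Vopenka_Principle :: "'v itself \<Rightarrow> bool" where
  "Vopenka_Principle V \<longleftrightarrow>
     \<not> (\<exists>\<C> :: 'v graph set. (\<forall>G\<in>\<C>. is_graph G) \<and> \<not> small V \<C> \<and> rigid \<C>)"

section \<open>Categories, functors and colimits\<close>

record ('o, 'm) cat =
  Obj :: "'o set"
  Mor :: "'m set"
  Dom :: "'m \<Rightarrow> 'o"
  Cod :: "'m \<Rightarrow> 'o"
  Ident :: "'o \<Rightarrow> 'm"
  Comp :: "'m \<Rightarrow> 'm \<Rightarrow> 'm"  \<comment> \<open>\<open>Comp C g f\<close> is \<open>g\<close> after \<open>f\<close>\<close>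

definition hom :: "('o, 'm) cat \<Rightarrow> 'o \<Rightarrow> 'o \<Rightarrow> 'm set" where
  "hom C X Y = {f \<in> Mor C. Dom C f = X \<and> Cod C f = Y}"

definition is_category :: "('o, 'm) cat \<Rightarrow> bool" where
  "is_category C \<longleftrightarrow>
     (\<forall>f\<in>Mor C. Dom C f \<in> Obj C \<and> Cod C f \<in> Obj C) \<and>
     (\<forall>X\<in>Obj C. Ident C X \<in> hom C X X) \<and>
     (\<forall>X Y Z f g. f \<in> hom C X Y \<and> g \<in> hom C Y Z \<longrightarrow> Comp C g f \<in> hom C X Z) \<and>
     (\<forall>X Y f. f \<in> hom C X Y \<longrightarrow> Comp C f (Ident C X) = f \<and> Comp C (Ident C Y) f = f) \<and>
     (\<forall>W X Y Z f g h. f \<in> hom C W X \<and> g \<in> hom C X Y \<and> h \<in> hom C Y Z \<longrightarrow>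
        Comp C h (Comp C g f) = Comp C (Comp C h g) f)"

definition locally_small :: "'v itself \<Rightarrow> ('o, 'm) cat \<Rightarrow> bool" where
  "locally_small V C \<longleftrightarrow> (\<forall>X\<in>Obj C. \<forall>Y\<in>Obj C. small V (hom C X Y))"

definition small_category :: "'v itself \<Rightarrow> ('o, 'm) cat \<Rightarrow> bool" where
  "small_category V C \<longleftrightarrow> is_category C \<and> small V (Obj C) \<and> small V (Mor C)"

definition full_subcategory :: "('o, 'm) cat \<Rightarrow> 'o set \<Rightarrow> ('o, 'm) cat" where
  "full_subcategory C S =
     C\<lparr>Obj := S, Mor := {f \<in> Mor C. Dom C f \<in> S \<and> Cod C f \<in> S}\<rparr>"

record ('o, 'm, 'p, 'n) func =
  FObj :: "'o \<Rightarrow> 'p"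
  FMor :: "'m \<Rightarrow> 'n"

definition is_functor ::
  "('o, 'm) cat \<Rightarrow> ('p, 'n) cat \<Rightarrow> ('o, 'm, 'p, 'n) func \<Rightarrow> bool" where
  "is_functor C D F \<longleftrightarrow>
     (\<forall>X\<in>Obj C. FObj F X \<in> Obj D) \<and>
     (\<forall>X\<in>Obj C. \<forall>Y\<in>Obj C. \<forall>f\<in>hom C X Y. FMor F f \<in> hom D (FObj F X) (FObj F Y)) \<and>
     (\<forall>X\<in>Obj C. FMor F (Ident C X) = Ident D (FObj F X)) \<and>
     (\<forall>X Y Z f g. f \<in> hom C X Y \<and> g \<in> hom C Y Z \<longrightarrow>
        FMor F (Comp C g f) = Comp D (FMor F g) (FMor F f))"

definition functor_comp ::
  "('p, 'n, 'q, 'k) func \<Rightarrow> ('o, 'm, 'p, 'n) func \<Rightarrow> ('o, 'm, 'q, 'k) func" where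
  "functor_comp G F = \<lparr>FObj = FObj G \<circ> FObj F, FMor = FMor G \<circ> FMor F\<rparr>"

definition is_cocone ::
  "('i, 'j) cat \<Rightarrow> ('o, 'm) cat \<Rightarrow> ('i, 'j, 'o, 'm) func \<Rightarrow> 'o \<Rightarrow> ('i \<Rightarrow> 'm) \<Rightarrow> bool" where
  "is_cocone J C D X c \<longleftrightarrow>
     X \<in> Obj C \<and>
     (\<forall>i\<in>Obj J. c i \<in> hom C (FObj D i) X) \<and>
     (\<forall>i\<in>Obj J. \<forall>j\<in>Obj J. \<forall>u\<in>hom J i j. Comp C (c j) (FMor D u) = c i)"

definition is_colimit ::
  "('i, 'j) cat \<Rightarrow> ('o, 'm) cat \<Rightarrow> ('i, 'j, 'o, 'm) func \<Rightarrow> 'o \<Rightarrow> ('i \<Rightarrow> 'm) \<Rightarrow> bool" where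
  "is_colimit J C D X c \<longleftrightarrow>
     is_cocone J C D X c \<and>
     (\<forall>Y d. is_cocone J C D Y d \<longrightarrow>
        (\<exists>!u. u \<in> hom C X Y \<and> (\<forall>i\<in>Obj J. Comp C u (c i) = d i)))"

text \<open>
  Every small category is isomorphic to one whose objects and morphisms are elements of
  \<open>'v\<close>, so in the definitions below that quantify over small diagrams (or over the shapes of
  such diagrams) the index categories are taken in \<open>'v\<close>.
\<close>

definition cocomplete :: "('v, 'v) cat \<Rightarrow> bool" where
  "cocomplete K \<longleftrightarrow>
     (\<forall>(J :: ('v, 'v) cat) D. small_category TYPE('v) J \<and> is_functor J K D \<longrightarrow>
        (\<exists>X c. is_colimit J K D X c))"

section \<open>Dense and colimit-dense subcategories\<close>

text \<open>
  A full subcategory of \<open>K\<close> is given by its class of objects; when \<open>K\<close> is locally small, the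
  subcategory is small iff this class is.

  An object \<open>g : G \<rightarrow> X\<close> of the comma category \<open>S / X\<close> is represented by the morphism
  \<open>g\<close> alone, which determines \<open>G\<close>; a morphism from \<open>g\<close> to \<open>g'\<close> over \<open>h\<close> is the triple
  \<open>(g, h, g')\<close>.
\<close>

definition comma :: "('o, 'm) cat \<Rightarrow> 'o set \<Rightarrow> 'o \<Rightarrow> ('m, 'm \<times> 'm \<times> 'm) cat" where
  "comma K S X =
     \<lparr>Obj = {g \<in> Mor K. Dom K g \<in> S \<and> Cod K g = X},
      Mor = {(g, h, g') | g h g'.
               g \<in> Mor K \<and> Dom K g \<in> S \<and> Cod K g = X \<and>
               g' \<in> Mor K \<and> Dom K g' \<in> S \<and> Cod K g' = X \<and>
               h \<in> hom K (Dom K g) (Dom K g') \<and> Comp K g' h = g},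
      Dom = (\<lambda>(g, h, g'). g),
      Cod = (\<lambda>(g, h, g'). g'),
      Ident = (\<lambda>g. (g, Ident K (Dom K g), g)),
      Comp = (\<lambda>(g', k, g'') (g, h, _). (g, Comp K k h, g''))\<rparr>"

definition canonical_diagram :: "('o, 'm) cat \<Rightarrow> ('m, 'm \<times> 'm \<times> 'm, 'o, 'm) func" where
  "canonical_diagram K = \<lparr>FObj = Dom K, FMor = (\<lambda>(g, h, g'). h)\<rparr>"

definition dense_subcategory :: "('v, 'v) cat \<Rightarrow> 'v set \<Rightarrow> bool" where
  "dense_subcategory K S \<longleftrightarrow>
     S \<subseteq> Obj K \<and> small TYPE('v) S \<and>
     (\<forall>X\<in>Obj K. is_colimit (comma K S X) K (canonical_diagram K) X (\<lambda>g. g))"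

definition bounded_category :: "('v, 'v) cat \<Rightarrow> bool" where
  "bounded_category K \<longleftrightarrow> (\<exists>S. dense_subcategory K S)"

definition colimit_dense_subcategory :: "('v, 'v) cat \<Rightarrow> 'v set \<Rightarrow> bool" where
  "colimit_dense_subcategory K S \<longleftrightarrow>
     S \<subseteq> Obj K \<and> small TYPE('v) S \<and>
     (\<forall>X\<in>Obj K. \<exists>(J :: ('v, 'v) cat) D c.
        small_category TYPE('v) J \<and> is_functor J (full_subcategory K S) D \<and>
        is_colimit J K D X c)"

section \<open>Presentable generators\<close>

text \<open>
  The category of sets: a morphism is a triple of domain, underlying function (made
  \<open>undefined\<close> outside the domain, so that equality of morphisms is equality of
  functions on the domain) and codomain.
\<close>

definition Set_cat :: "('v set, 'v set \<times> ('v \<Rightarrow> 'v) \<times> 'v set) cat" where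
  "Set_cat =
     \<lparr>Obj = {A. small TYPE('v) A},
      Mor = {(A, f, B) | A f B. small TYPE('v) A \<and> small TYPE('v) B \<and> f \<in> A \<rightarrow>\<^sub>E B},
      Dom = (\<lambda>(A, f, B). A),
      Cod = (\<lambda>(A, f, B). B),
      Ident = (\<lambda>A. (A, restrict (\<lambda>x. x) A, A)),
      Comp = (\<lambda>(_, g, C) (A, f, _). (A, compose A g f, C))\<rparr>"

definition hom_functor ::
  "('o, 'v) cat \<Rightarrow> 'o \<Rightarrow> ('o, 'v, 'v set, 'v set \<times> ('v \<Rightarrow> 'v) \<times> 'v set) func" where
  "hom_functor K G =
     \<lparr>FObj = (\<lambda>X. hom K G X),
      FMor = (\<lambda>f. (hom K G (Dom K f),
                   restrict (\<lambda>h. Comp K f h) (hom K G (Dom K f)),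
                   hom K G (Cod K f)))\<rparr>"

text \<open>
  A regular cardinal of the universe, represented as a cardinal order on (a subset of)
  \<open>'v\<close>; like every set, it is smaller than the universe.
\<close>

definition regular_cardinal :: "'v rel \<Rightarrow> bool" where
  "regular_cardinal \<kappa> \<longleftrightarrow> Cinfinite \<kappa> \<and> regularCard \<kappa> \<and> \<kappa> <o |UNIV :: 'v set|"

text \<open>
  Every diagram in \<open>J\<close> with fewer than \<open>\<kappa>\<close> morphisms has a cocone.
\<close>

definition filtered :: "'v rel \<Rightarrow> ('v, 'v) cat \<Rightarrow> bool" where
  "filtered \<kappa> J \<longleftrightarrow>
     (\<forall>(I :: ('v, 'v) cat) D. is_category I \<and> |Mor I| <o \<kappa> \<and> is_functor I J D \<longrightarrow>
        (\<exists>j c. is_cocone I J D j c))"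

definition preserves_filtered_colimits ::
  "'v rel \<Rightarrow> ('v, 'v) cat \<Rightarrow> ('p, 'n) cat \<Rightarrow> ('v, 'v, 'p, 'n) func \<Rightarrow> bool" where
  "preserves_filtered_colimits \<kappa> K L F \<longleftrightarrow>
     (\<forall>(J :: ('v, 'v) cat) D X c.
        small_category TYPE('v) J \<and> filtered \<kappa> J \<and> is_functor J K D \<and>
        is_colimit J K D X c \<longrightarrow>
        is_colimit J L (functor_comp F D) (FObj F X) (\<lambda>i. FMor F (c i)))"

definition presentable :: "('v, 'v) cat \<Rightarrow> 'v \<Rightarrow> bool" where
  "presentable K G \<longleftrightarrow>
     (\<exists>\<kappa>. regular_cardinal \<kappa> \<and> preserves_filtered_colimits \<kappa> K Set_cat (hom_functor K G))"

definition generator :: "('v, 'v) cat \<Rightarrow> 'v set \<Rightarrow> bool" where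
  "generator K S \<longleftrightarrow>
     S \<subseteq> Obj K \<and> small TYPE('v) S \<and>
     (\<forall>X\<in>Obj K. \<forall>Y\<in>Obj K. \<forall>f\<in>hom K X Y. \<forall>g\<in>hom K X Y.
        (\<forall>G\<in>S. FMor (hom_functor K G) f = FMor (hom_functor K G) g) \<longrightarrow> f = g)"

definition presentable_generator :: "('v, 'v) cat \<Rightarrow> 'v set \<Rightarrow> bool" where
  "presentable_generator K S \<longleftrightarrow> generator K S \<and> (\<forall>G\<in>S. presentable K G)"

end

theory Submission
  imports Defs
begin

text \<open>
  Let \<open>S\<close> be colimit-dense, \<open>G\<close> a presentable generator, and \<open>M\<close> a small infinite set whose
  cardinality bounds the cardinals witnessing presentability of the members of \<open>G\<close>. The dense
  subcategory consists of \<open>G\<close> together with representatives of the colimits of all diagrams in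
  \<open>S\<close> with at most \<open>|M|\<close> objects.

  A small set \<open>R\<close> of representatives suffices: the cocones of a diagram depend only on the
  triples (source, value, target) of its arrows, so once the index objects are named by
  elements of \<open>M\<close>, the colimit is determined up to isomorphism by a subset of
  \<open>M \<times> N \<times> M\<close>, where \<open>N\<close> is the small set of morphisms between members of \<open>S\<close>
  (\<open>colimit_transfer\<close>).

  Write an object \<open>X\<close> as a colimit of a diagram \<open>D : J \<rightarrow> S\<close>. The sets of at most \<open>|M|\<close> objects
  of \<open>J\<close> are closed under unions of at most \<open>|M|\<close> members, and \<open>X\<close> is the colimit, over
  this directed poset, of the colimits of the corresponding restrictions of \<open>D\<close>
  (\<open>colimit_of_directed_family\<close>). So \<open>X\<close> is a colimit of objects \<open>E\<^sub>i \<in> R\<close>, with legs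
  \<open>c\<^sub>i : E\<^sub>i \<rightarrow> X\<close>, and the diagram is filtered enough for every map from a member of \<open>G\<close> to
  \<open>X\<close> to factor through some leg (\<open>presentable_factorization\<close>).

  This makes \<open>X\<close> the canonical colimit (\<open>canonical_colimit_if_generator_factors\<close>). A cocone
  \<open>d\<close> on the canonical diagram with vertex \<open>Y\<close> restricts to the cocone \<open>d c\<^sub>i\<close>, hence induces a
  unique \<open>f : X \<rightarrow> Y\<close> with \<open>f c\<^sub>i = d c\<^sub>i\<close>. To see \<open>f g = d g\<close> for an arbitrary \<open>g : A \<rightarrow> X\<close>, test
  on maps \<open>h : B \<rightarrow> A\<close> with \<open>B \<in> G\<close> and factor \<open>g h = c\<^sub>i k\<close>; then
  \<open>f g h = f c\<^sub>i k = (d c\<^sub>i) k = d (c\<^sub>i k) = d (g h) = (d g) h\<close>, where compatibility of \<open>d\<close> may be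
  used because \<open>B\<close> itself belongs to the subcategory.
\<close>

section \<open>Small sets\<close>

lemma set_universe_infinite:
  assumes "set_universe TYPE('v)"
  shows "infinite (UNIV :: 'v set)"
  using assms unfolding set_universe_def
  by (meson infinite_iff_natLeq_ordLeq ordLess_imp_ordLeq)

lemma small_ordLeq:
  "small V B \<Longrightarrow> |A| \<le>o |B| \<Longrightarrow> small V A"
  unfolding small_def by (rule ordLeq_ordLess_trans)

lemma small_subset: "small V B \<Longrightarrow> A \<subseteq> B \<Longrightarrow> small V A"
  by (meson small_ordLeq card_of_mono1)

lemma small_image: "small V A \<Longrightarrow> small V (f ` A)"
  by (meson small_ordLeq card_of_image)

lemma small_finite:
  assumes "set_universe TYPE('v)" and "finite A"
  shows "small TYPE('v) A"
  using assms(2) set_universe_infinite[OF assms(1)] unfolding small_def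
  by (intro finite_ordLess_infinite[OF card_of_Well_order card_of_Well_order])
    (simp_all add: Field_card_of)

lemma small_imp_inj_on:
  assumes "small TYPE('v) A"
  obtains e :: "'a \<Rightarrow> 'v" where "inj_on e A"
  using assms ordLess_imp_ordLeq unfolding small_def by (metis card_of_ordLeq)

lemma small_UN:
  assumes V: "set_universe TYPE('v)" and "small TYPE('v) I"
    and "\<And>i. i \<in> I \<Longrightarrow> small TYPE('v) (A i)"
  shows "small TYPE('v) (\<Union>i\<in>I. A i)"
proof -
  have "stable |UNIV :: 'v set|"
    using V set_universe_infinite[OF V] unfolding set_universe_def
    by (intro regularCard_stable[OF card_of_Card_order]) (simp_all add: Field_card_of)
  then show ?thesis
    using assms(2,3) unfolding small_def by (intro stable_UNION) auto
qed

lemma small_Un: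
  assumes V: "set_universe TYPE('v)" and "small TYPE('v) A" and "small TYPE('v) B"
  shows "small TYPE('v) (A \<union> B)"
proof -
  have "small TYPE('v) (\<Union>b\<in>UNIV. if b then A else B)"
    using assms small_finite[OF V, of "UNIV :: bool set"] by (intro small_UN[OF V]) auto
  then show ?thesis
    by (simp add: UNIV_bool Un_commute)
qed

lemma small_Times:
  assumes "set_universe TYPE('v)" and "small TYPE('v) A" and "small TYPE('v) B"
  shows "small TYPE('v) (A \<times> B)"
proof -
  have "A \<times> B = (\<Union>a\<in>A. Pair a ` B)"
    by auto
  then show ?thesis
    using assms by (simp add: small_UN small_image)
qed

lemma small_Pow:
  assumes V: "set_universe TYPE('v)" and A: "small TYPE('v) A"
  shows "small TYPE('v) (Pow A)"
proof -
  obtain e :: "'a \<Rightarrow> 'v" where e: "inj_on e A"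
    using A by (rule small_imp_inj_on)
  have "small TYPE('v) (Pow (e ` A))"
    using V small_image[OF A, of e] unfolding set_universe_def small_def by blast
  moreover have "|Pow A| \<le>o |Pow (e ` A)|"
    by (rule card_of_ordLeqI[of "image e"]) (use e inj_on_image_Pow in auto)
  ultimately show ?thesis
    by (rule small_ordLeq)
qed

text \<open>
  The union of the fields of the cardinals is small by regularity of the universe; a countable
  set is added to make the bound infinite even when \<open>I\<close> is empty.
\<close>

lemma common_bound_of_cardinals:
  fixes \<kappa> :: "'a \<Rightarrow> 'v rel"
  assumes V: "set_universe TYPE('v)" and I: "small TYPE('v) I"
    and \<kappa>: "\<And>i. i \<in> I \<Longrightarrow> regular_cardinal (\<kappa> i)"
  obtains M :: "'v set"
  where "infinite M" and "small TYPE('v) M" and "\<And>i. i \<in> I \<Longrightarrow> \<kappa> i \<le>o |M|"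
proof -
  obtain f :: "nat \<Rightarrow> 'v" where f: "inj f"
    using set_universe_infinite[OF V] infinite_countable_subset by blast
  have "|UNIV :: nat set| <o |UNIV :: 'v set|"
    using V card_of_nat ordIso_ordLess_trans unfolding set_universe_def by blast
  then have "small TYPE('v) (UNIV :: nat set)"
    by (simp add: small_def)
  then have fs: "small TYPE('v) (range f)"
    by (rule small_image)
  have co: "Card_order (\<kappa> i)" if "i \<in> I" for i
    using \<kappa>[OF that] unfolding regular_cardinal_def by blast
  have "small TYPE('v) (Field (\<kappa> i))" if "i \<in> I" for i
    using \<kappa>[OF that] card_of_Field_ordIso[OF co[OF that]] ordIso_ordLess_trans
    unfolding regular_cardinal_def small_def by blast
  then have us: "small TYPE('v) (\<Union>i\<in>I. Field (\<kappa> i))"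
    using V I by (simp add: small_UN)
  define M where "M = range f \<union> (\<Union>i\<in>I. Field (\<kappa> i))"
  have "small TYPE('v) M"
    unfolding M_def using small_Un[OF V fs us] .
  moreover have "infinite M"
    using f finite_imageD[of f UNIV] unfolding M_def by auto
  moreover have "\<kappa> i \<le>o |M|" if i: "i \<in> I" for i
  proof -
    have "Field (\<kappa> i) \<subseteq> M"
      unfolding M_def using i by (auto split: if_splits)
    then show ?thesis
      using card_of_mono1 ordIso_ordLeq_trans ordIso_symmetric
        card_of_Field_ordIso[OF co[OF i]] by blast
  qed
  ultimately show thesis
    using that by blast
qed

section \<open>Categories and cocones\<close>

lemma homI: "f \<in> Mor C \<Longrightarrow> f \<in> hom C (Dom C f) (Cod C f)"
  by (simp add: hom_def)

lemma hom_objects: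
  assumes "is_category C" and "f \<in> hom C X Y"
  shows "X \<in> Obj C" and "Y \<in> Obj C"
  using assms unfolding is_category_def hom_def by auto

lemma ident_in_hom: "is_category C \<Longrightarrow> X \<in> Obj C \<Longrightarrow> Ident C X \<in> hom C X X"
  unfolding is_category_def by blast

lemma comp_in_hom:
  "is_category C \<Longrightarrow> f \<in> hom C X Y \<Longrightarrow> g \<in> hom C Y Z \<Longrightarrow> Comp C g f \<in> hom C X Z"
  unfolding is_category_def by blast

lemma comp_ident:
  assumes "is_category C" and "f \<in> hom C X Y"
  shows "Comp C f (Ident C X) = f" and "Comp C (Ident C Y) f = f"
  using assms unfolding is_category_def by blast+

lemma comp_assoc:
  "is_category C \<Longrightarrow> f \<in> hom C W X \<Longrightarrow> g \<in> hom C X Y \<Longrightarrow> h \<in> hom C Y Z \<Longrightarrow>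
    Comp C h (Comp C g f) = Comp C (Comp C h g) f"
  unfolding is_category_def by blast

lemma hom_full_subcategory:
  "f \<in> hom (full_subcategory C S) X Y \<longleftrightarrow> f \<in> hom C X Y \<and> X \<in> S \<and> Y \<in> S"
  unfolding hom_def full_subcategory_def by auto

lemma Obj_full_subcategory [simp]: "Obj (full_subcategory C S) = S"
  by (simp add: full_subcategory_def)

lemma Ident_full_subcategory [simp]: "Ident (full_subcategory C S) = Ident C"
  by (simp add: full_subcategory_def)

lemma Comp_full_subcategory [simp]: "Comp (full_subcategory C S) = Comp C"
  by (simp add: full_subcategory_def)

lemma full_subcategory_is_category:
  assumes C: "is_category C" and S: "S \<subseteq> Obj C"
  shows "is_category (full_subcategory C S)"
proof -
  have "\<forall>f\<in>Mor (full_subcategory C S).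
      Dom (full_subcategory C S) f \<in> S \<and> Cod (full_subcategory C S) f \<in> S"
    by (simp add: full_subcategory_def)
  moreover have "\<forall>X\<in>S. Ident C X \<in> hom C X X"
    using ident_in_hom[OF C] S by blast
  ultimately show ?thesis
    unfolding is_category_def[of "full_subcategory C S"]
      hom_full_subcategory Obj_full_subcategory Ident_full_subcategory Comp_full_subcategory
    by (intro conjI allI impI ballI;
        (elim conjE)?; simp add: comp_in_hom[OF C] comp_ident[OF C] comp_assoc[OF C])
qed

lemma small_full_subcategory:
  assumes J: "small_category V J" and U: "U \<subseteq> Obj J"
  shows "small_category V (full_subcategory J U)"
proof -
  have "Mor (full_subcategory J U) \<subseteq> Mor J"
    by (auto simp: full_subcategory_def)
  then show ?thesis
    using J U full_subcategory_is_category small_subset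
    unfolding small_category_def by (metis Obj_full_subcategory)
qed

lemma functorI:
  assumes "\<And>i. i \<in> Obj J \<Longrightarrow> FObj D i \<in> Obj K"
    and "\<And>i j u. i \<in> Obj J \<Longrightarrow> j \<in> Obj J \<Longrightarrow> u \<in> hom J i j \<Longrightarrow>
      FMor D u \<in> hom K (FObj D i) (FObj D j)"
    and "\<And>i. i \<in> Obj J \<Longrightarrow> FMor D (Ident J i) = Ident K (FObj D i)"
    and "\<And>i j k u v. u \<in> hom J i j \<Longrightarrow> v \<in> hom J j k \<Longrightarrow>
      FMor D (Comp J v u) = Comp K (FMor D v) (FMor D u)"
  shows "is_functor J K D"
  unfolding is_functor_def
  by (intro conjI ballI allI impI; (elim conjE)?; rule assms; assumption)

lemma functor_FObj: "is_functor J K D \<Longrightarrow> i \<in> Obj J \<Longrightarrow> FObj D i \<in> Obj K"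
  unfolding is_functor_def by simp

lemma functor_FMor:
  assumes "is_category J" and "is_functor J K D" and "u \<in> hom J i j"
  shows "FMor D u \<in> hom K (FObj D i) (FObj D j)"
  using assms(2,3) hom_objects[OF assms(1,3)] unfolding is_functor_def by simp

lemma functor_Ident:
  "is_functor J K D \<Longrightarrow> i \<in> Obj J \<Longrightarrow> FMor D (Ident J i) = Ident K (FObj D i)"
  unfolding is_functor_def by simp

lemma functor_Comp:
  assumes "is_functor J K D" and "u \<in> hom J i j" and "v \<in> hom J j k"
  shows "FMor D (Comp J v u) = Comp K (FMor D v) (FMor D u)"
proof -
  have "\<forall>X Y Z f g. f \<in> hom J X Y \<and> g \<in> hom J Y Z \<longrightarrow>
      FMor D (Comp J g f) = Comp K (FMor D g) (FMor D f)"
    using assms(1) unfolding is_functor_def by (elim conjE)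
  then show ?thesis
    using assms(2,3) by blast
qed

lemma functor_restrict_domain:
  assumes J: "is_category J" and D: "is_functor J K D" and U: "U \<subseteq> Obj J"
  shows "is_functor (full_subcategory J U) K D"
  by (rule functorI)
    (use functor_FObj[OF D] functor_FMor[OF J D] functor_Ident[OF D] functor_Comp[OF D] U in
      \<open>auto simp: hom_full_subcategory\<close>)

lemma functor_into_full_subcategory:
  assumes J: "is_category J" and D: "is_functor J (full_subcategory K S) D" and S: "S \<subseteq> Obj K"
  shows "is_functor J K D"
  by (rule functorI)
    (use functor_FObj[OF D] functor_FMor[OF J D] functor_Ident[OF D] functor_Comp[OF D] S in
      \<open>auto simp: hom_full_subcategory\<close>)

lemma cocone_object: "is_cocone J K D X c \<Longrightarrow> X \<in> Obj K"
  unfolding is_cocone_def by blast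

lemma cocone_leg: "is_cocone J K D X c \<Longrightarrow> i \<in> Obj J \<Longrightarrow> c i \<in> hom K (FObj D i) X"
  unfolding is_cocone_def by blast

lemma cocone_natural:
  "is_category J \<Longrightarrow> is_cocone J K D X c \<Longrightarrow> u \<in> hom J i j \<Longrightarrow> Comp K (c j) (FMor D u) = c i"
  unfolding is_cocone_def by (metis hom_objects)

lemma colimit_cocone: "is_colimit J K D X c \<Longrightarrow> is_cocone J K D X c"
  unfolding is_colimit_def by blast

lemma colimit_factor:
  assumes "is_colimit J K D X c" and "is_cocone J K D Y d"
  obtains f where "f \<in> hom K X Y" and "\<And>i. i \<in> Obj J \<Longrightarrow> Comp K f (c i) = d i"
  using assms unfolding is_colimit_def by blast

lemma cocone_compose:
  assumes J: "is_category J" and K: "is_category K" and D: "is_functor J K D"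
    and c: "is_cocone J K D X c" and f: "f \<in> hom K X Y"
  shows "is_cocone J K D Y (\<lambda>i. Comp K f (c i))"
  unfolding is_cocone_def
proof (intro conjI ballI)
  show "Y \<in> Obj K"
    using hom_objects[OF K f] by blast
  fix i assume i: "i \<in> Obj J"
  then show "Comp K f (c i) \<in> hom K (FObj D i) Y"
    using comp_in_hom[OF K cocone_leg[OF c] f] by blast
  fix j u assume j: "j \<in> Obj J" and u: "u \<in> hom J i j"
  have "Comp K (Comp K f (c j)) (FMor D u) = Comp K f (Comp K (c j) (FMor D u))"
    using comp_assoc[OF K functor_FMor[OF J D u] cocone_leg[OF c j] f] by simp
  then show "Comp K (Comp K f (c j)) (FMor D u) = Comp K f (c i)"
    using cocone_natural[OF J c u] by simp
qed

lemma colimit_jointly_epi: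
  assumes J: "is_category J" and K: "is_category K" and D: "is_functor J K D"
    and c: "is_colimit J K D X c" and f: "f \<in> hom K X Y" and g: "g \<in> hom K X Y"
    and eq: "\<And>i. i \<in> Obj J \<Longrightarrow> Comp K f (c i) = Comp K g (c i)"
  shows "f = g"
proof -
  have "is_cocone J K D Y (\<lambda>i. Comp K f (c i))"
    using cocone_compose[OF J K D colimit_cocone[OF c] f] .
  then have "\<exists>!u. u \<in> hom K X Y \<and> (\<forall>i\<in>Obj J. Comp K u (c i) = Comp K f (c i))"
    using c unfolding is_colimit_def by blast
  then show ?thesis
    using f g eq by (metis (no_types, lifting))
qed

section \<open>Maps out of a presentable object\<close>

lemma hom_Set_cat_iff:
  fixes A B :: "'v set"
  shows "t \<in> hom Set_cat A B \<longleftrightarrow>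
    (\<exists>f. t = (A, f, B) \<and> small TYPE('v) A \<and> small TYPE('v) B \<and> f \<in> A \<rightarrow>\<^sub>E B)"
  unfolding hom_def Set_cat_def by auto

text \<open>
  Test against a two-element set: the characteristic map of the union of the images and the
  constant map agree on every leg of the cocone, so they are equal.
\<close>

lemma Set_colimit_jointly_surjective:
  fixes X :: "'v set"
  assumes V: "set_universe TYPE('v)"
    and mor: "\<And>i j u. i \<in> Obj J \<Longrightarrow> j \<in> Obj J \<Longrightarrow> u \<in> hom J i j \<Longrightarrow>
      FMor D u \<in> hom Set_cat (FObj D i) (FObj D j)"
    and colim: "is_colimit J Set_cat D X c" and x: "x \<in> X"
  shows "\<exists>i\<in>Obj J. x \<in> fst (snd (c i)) ` FObj D i"
proof (rule ccontr)
  assume no: "\<not> ?thesis"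
  obtain p q :: 'v where pq: "p \<noteq> q"
    using set_universe_infinite[OF V] by (metis ex_new_if_finite finite.emptyI finite_insert singletonI)
  let ?B = "{p, q}"
  have B: "small TYPE('v) ?B"
    using V by (simp add: small_finite)
  have cc: "is_cocone J Set_cat D X c"
    using colim by (rule colimit_cocone)
  have X: "small TYPE('v) X"
    using cocone_object[OF cc] by (simp add: Set_cat_def)
  define d where "d i = (FObj D i, restrict (\<lambda>_. p) (FObj D i), ?B)" for i
  define v where "v = (X, restrict (\<lambda>_. p) X, ?B)"
  define w where "w = (X, restrict (\<lambda>y. if y = x then q else p) X, ?B)"
  have leg: "\<exists>f. c i = (FObj D i, f, X) \<and> small TYPE('v) (FObj D i) \<and> f \<in> FObj D i \<rightarrow>\<^sub>E X"
    if "i \<in> Obj J" for i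
    using cocone_leg[OF cc that] unfolding hom_Set_cat_iff by blast
  have "v \<in> hom Set_cat X ?B" "w \<in> hom Set_cat X ?B"
    unfolding v_def w_def hom_Set_cat_iff using X B by auto
  moreover have vc: "Comp Set_cat v (c i) = d i" if "i \<in> Obj J" for i
    using leg[OF that] unfolding v_def d_def Set_cat_def compose_def
    by (auto simp: fun_eq_iff restrict_def PiE_def Pi_def)
  moreover have wc: "Comp Set_cat w (c i) = d i" if i: "i \<in> Obj J" for i
  proof -
    obtain f where f: "c i = (FObj D i, f, X)" "f \<in> FObj D i \<rightarrow>\<^sub>E X"
      using leg[OF i] by blast
    have "f y \<noteq> x" if "y \<in> FObj D i" for y
      using no i f that by force
    then show ?thesis
      using f unfolding w_def d_def Set_cat_def compose_def
      by (auto simp: fun_eq_iff restrict_def PiE_def Pi_def)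
  qed
  moreover have "is_cocone J Set_cat D ?B d"
    unfolding is_cocone_def
  proof (intro conjI ballI)
    show "?B \<in> Obj Set_cat"
      using B by (simp add: Set_cat_def)
    fix i assume i: "i \<in> Obj J"
    show "d i \<in> hom Set_cat (FObj D i) ?B"
      using leg[OF i] B unfolding d_def hom_Set_cat_iff by auto
    fix j u assume j: "j \<in> Obj J" and u: "u \<in> hom J i j"
    obtain f where f: "FMor D u = (FObj D i, f, FObj D j)" "f \<in> FObj D i \<rightarrow>\<^sub>E FObj D j"
      using mor[OF i j u] unfolding hom_Set_cat_iff by blast
    then show "Comp Set_cat (d j) (FMor D u) = d i"
      unfolding d_def Set_cat_def compose_def
      by (auto simp: fun_eq_iff restrict_def PiE_def Pi_def)
  qed
  ultimately have "v = w"
    using colim unfolding is_colimit_def by (metis (no_types, lifting))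
  then show False
    using x pq unfolding v_def w_def by (auto simp: fun_eq_iff restrict_def split: if_splits)
qed

lemma FMor_hom_functor:
  "f \<in> hom K X Y \<Longrightarrow>
    FMor (hom_functor K G) f = (hom K G X, restrict (Comp K f) (hom K G X), hom K G Y)"
  unfolding hom_functor_def hom_def by simp

text \<open>
  The hom-functor of \<open>G\<close> turns the colimit cocone into a colimit cocone of sets, and such a
  cocone is jointly surjective.
\<close>

lemma presentable_factorization:
  fixes K :: "('v, 'v) cat"
  assumes V: "set_universe TYPE('v)" and K: "is_category K" and ls: "locally_small TYPE('v) K"
    and pres: "preserves_filtered_colimits \<kappa> K Set_cat (hom_functor K G)"
    and J: "small_category TYPE('v) J" and filt: "filtered \<kappa> J" and D: "is_functor J K D"
    and c: "is_colimit J K D X c" and h: "h \<in> hom K G X"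
  shows "\<exists>i\<in>Obj J. \<exists>k\<in>hom K G (FObj D i). Comp K (c i) k = h"
proof -
  let ?H = "hom_functor K G" and ?D = "functor_comp (hom_functor K G) D"
  have J': "is_category J"
    using J unfolding small_category_def by blast
  have G: "G \<in> Obj K"
    using hom_objects[OF K h] by blast
  have FObj: "FObj ?D i = hom K G (FObj D i)" for i
    by (simp add: functor_comp_def hom_functor_def)
  have "is_colimit J Set_cat ?D (FObj ?H X) (\<lambda>i. FMor ?H (c i))"
    using pres J filt D c unfolding preserves_filtered_colimits_def by blast
  moreover have "FMor ?D u \<in> hom Set_cat (FObj ?D i) (FObj ?D j)"
    if "i \<in> Obj J" "j \<in> Obj J" "u \<in> hom J i j" for i j u
  proof -
    have Du: "FMor D u \<in> hom K (FObj D i) (FObj D j)"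
      using functor_FMor[OF J' D that(3)] .
    have "small TYPE('v) (hom K G (FObj D i))" "small TYPE('v) (hom K G (FObj D j))"
      using ls G functor_FObj[OF D] that unfolding locally_small_def by blast+
    moreover have "restrict (Comp K (FMor D u)) (hom K G (FObj D i))
        \<in> hom K G (FObj D i) \<rightarrow>\<^sub>E hom K G (FObj D j)"
      using comp_in_hom[OF K _ Du] by auto
    moreover have "FMor ?D u = FMor ?H (FMor D u)"
      by (simp add: functor_comp_def)
    ultimately show ?thesis
      unfolding hom_Set_cat_iff FObj using FMor_hom_functor[OF Du] by metis
  qed
  moreover have "h \<in> FObj ?H X"
    using h by (simp add: hom_functor_def)
  ultimately obtain i where i: "i \<in> Obj J"
    and "h \<in> fst (snd (FMor ?H (c i))) ` FObj ?D i"
    using Set_colimit_jointly_surjective[OF V, of J ?D] by blast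
  then show ?thesis
    using FMor_hom_functor[OF cocone_leg[OF colimit_cocone[OF c] i], of G]
    unfolding FObj by auto
qed

section \<open>A small set of representative colimits\<close>

text \<open>
  The labelled graph underlying a diagram: \<open>e\<close> names the index objects, and each arrow is recorded
  only by its endpoints and its value. Parallel index arrows with the same value are identified, so
  the code can be much smaller than the index category.
\<close>

definition diagram_code ::
  "('i, 'j) cat \<Rightarrow> ('i, 'j, 'o, 'm) func \<Rightarrow> ('i \<Rightarrow> 'e) \<Rightarrow> ('e \<times> 'm \<times> 'e) set" where
  "diagram_code J D e =
     {(e i, FMor D u, e j) | i j u. i \<in> Obj J \<and> j \<in> Obj J \<and> u \<in> hom J i j}"

lemma diagram_codeI:
  assumes "is_category J" and "u \<in> hom J i j"
  shows "(e i, FMor D u, e j) \<in> diagram_code J D e"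
  unfolding diagram_code_def using hom_objects[OF assms] assms(2) by blast

text \<open>
  The code contains the values of the identities, which determine the objects of the diagram.
\<close>

lemma diagram_code_object:
  assumes K: "is_category K" and J: "is_category J" and J': "is_category J'"
    and D: "is_functor J K D" and D': "is_functor J' K D'" and e: "inj_on e (Obj J)"
    and code: "diagram_code J D e = diagram_code J' D' e'" and i': "i' \<in> Obj J'"
  shows "\<exists>i\<in>Obj J. e i = e' i' \<and> FObj D i = FObj D' i'"
proof -
  have "(e' i', FMor D' (Ident J' i'), e' i') \<in> diagram_code J D e"
    using diagram_codeI[OF J' ident_in_hom[OF J' i']] unfolding code .
  then obtain i j u where *: "i \<in> Obj J" "j \<in> Obj J" "u \<in> hom J i j"
      "e i = e' i'" "e j = e' i'" "FMor D u = FMor D' (Ident J' i')"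
    unfolding diagram_code_def by auto
  have "FMor D u \<in> hom K (FObj D i) (FObj D j)"
    using functor_FMor[OF J D *(3)] .
  moreover have "FMor D u \<in> hom K (FObj D' i') (FObj D' i')"
    using functor_FMor[OF J' D' ident_in_hom[OF J' i']] *(6) by simp
  ultimately have "FObj D i = FObj D' i'"
    unfolding hom_def by simp
  then show ?thesis
    using * by blast
qed

text \<open>
  The conditions on a cocone mention an index arrow only through its endpoints and its value, that
  is, through its triple in the code.
\<close>

lemma cocone_transfer:
  assumes K: "is_category K" and J: "is_category J" and J': "is_category J'"
    and D: "is_functor J K D" and D': "is_functor J' K D'" and e: "inj_on e (Obj J)"
    and code: "diagram_code J D e = diagram_code J' D' e'"
    and c: "is_cocone J K D X c"
  shows "is_cocone J' K D' X (\<lambda>i'. c (inv_into (Obj J) e (e' i')))"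
proof -
  define s where "s i' = inv_into (Obj J) e (e' i')" for i'
  have s_eq: "s i' = i" if "i \<in> Obj J" "e i = e' i'" for i i'
    unfolding s_def using inv_into_f_f[OF e that(1)] that(2) by simp
  have s: "s i' \<in> Obj J" "FObj D (s i') = FObj D' i'" if "i' \<in> Obj J'" for i'
    using diagram_code_object[OF K J J' D D' e code that] s_eq by blast+
  have "Comp K (c (s j')) (FMor D' u') = c (s i')"
    if "i' \<in> Obj J'" "j' \<in> Obj J'" "u' \<in> hom J' i' j'" for i' j' u'
  proof -
    have "(e' i', FMor D' u', e' j') \<in> diagram_code J D e"
      using diagram_codeI[OF J' that(3)] unfolding code .
    then obtain i j u where "i \<in> Obj J" "j \<in> Obj J" "u \<in> hom J i j"
        "e i = e' i'" "e j = e' j'" "FMor D u = FMor D' u'"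
      unfolding diagram_code_def by auto
    then show ?thesis
      using s_eq cocone_natural[OF J c] by metis
  qed
  then show ?thesis
    unfolding s_def[symmetric] is_cocone_def
    using cocone_object[OF c] cocone_leg[OF c] s by metis
qed

lemma colimit_transfer:
  assumes K: "is_category K" and J: "is_category J" and J': "is_category J'"
    and D: "is_functor J K D" and D': "is_functor J' K D'"
    and e: "inj_on e (Obj J)" and e': "inj_on e' (Obj J')"
    and code: "diagram_code J D e = diagram_code J' D' e'"
    and c: "is_colimit J K D X c"
  shows "is_colimit J' K D' X (\<lambda>i'. c (inv_into (Obj J) e (e' i')))"
proof -
  define s where "s i' = inv_into (Obj J) e (e' i')" for i'
  define t where "t i = inv_into (Obj J') e' (e i)" for i
  have s: "s i' \<in> Obj J \<and> t (s i') = i'" if "i' \<in> Obj J'" for i'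
    unfolding s_def t_def
    using diagram_code_object[OF K J J' D D' e code that] inv_into_f_f[OF e]
      inv_into_f_f[OF e' that] by metis
  have t: "t i \<in> Obj J' \<and> s (t i) = i" if "i \<in> Obj J" for i
    unfolding s_def t_def
    using diagram_code_object[OF K J' J D' D e' code[symmetric] that] inv_into_f_f[OF e']
      inv_into_f_f[OF e that] by metis
  have "\<exists>!f. f \<in> hom K X Y \<and> (\<forall>i'\<in>Obj J'. Comp K f (c (s i')) = d i')"
    if d: "is_cocone J' K D' Y d" for Y d
  proof -
    have "is_cocone J K D Y (\<lambda>i. d (t i))"
      unfolding t_def by (rule cocone_transfer[OF K J' J D' D e' code[symmetric] d])
    then have "\<exists>!f. f \<in> hom K X Y \<and> (\<forall>i\<in>Obj J. Comp K f (c i) = d (t i))"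
      using c unfolding is_colimit_def by blast
    moreover have "(\<forall>i\<in>Obj J. Comp K f (c i) = d (t i)) \<longleftrightarrow>
        (\<forall>i'\<in>Obj J'. Comp K f (c (s i')) = d i')" for f
      using s t by metis
    ultimately show ?thesis
      by simp
  qed
  then show ?thesis
    using cocone_transfer[OF K J J' D D' e code colimit_cocone[OF c]]
    unfolding is_colimit_def s_def by blast
qed

text \<open>
  Choosing the colimit by the code alone, rather than by the diagram, makes the chosen colimits
  literally range over a set indexed by the codes.
\<close>

definition colimit_of_code :: "('o, 'm) cat \<Rightarrow> ('v \<times> 'm \<times> 'v) set \<Rightarrow> 'o" where
  "colimit_of_code K R =
     (SOME X. \<exists>(J :: ('v, 'v) cat) D e c. is_category J \<and> is_functor J K D \<and>
        inj_on e (Obj J) \<and> diagram_code J D e = R \<and> is_colimit J K D X c)"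

lemma colimit_of_code:
  fixes J :: "('v, 'v) cat" and e :: "'v \<Rightarrow> 'v"
  assumes K: "is_category K" and J: "is_category J" and D: "is_functor J K D"
    and e: "inj_on e (Obj J)" and c: "is_colimit J K D X c"
  shows "\<exists>c'. is_colimit J K D (colimit_of_code K (diagram_code J D e)) c'"
proof -
  let ?R = "diagram_code J D e"
  have "\<exists>X (J :: ('v, 'v) cat) D e c. is_category J \<and> is_functor J K D \<and>
      inj_on e (Obj J) \<and> diagram_code J D e = ?R \<and> is_colimit J K D X c"
    using assms by blast
  then have "\<exists>(J :: ('v, 'v) cat) D e c. is_category J \<and> is_functor J K D \<and>
      inj_on e (Obj J) \<and> diagram_code J D e = ?R \<and>
      is_colimit J K D (colimit_of_code K ?R) c"
    unfolding colimit_of_code_def by (rule someI_ex)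
  then show ?thesis
    using colimit_transfer[OF K _ J _ D _ e] by blast
qed

section \<open>Directed families of subdiagrams\<close>

text \<open>
  The family \<open>P\<close>, ordered by inclusion, as a category. Its members and the pairs of them are
  encoded by \<open>enc\<close> and \<open>pair\<close> as elements of the universe, where index categories have to live.
\<close>

definition inclusion_category ::
  "('a set \<Rightarrow> 'v) \<Rightarrow> ('v \<times> 'v \<Rightarrow> 'v) \<Rightarrow> 'a set set \<Rightarrow> ('v, 'v) cat" where
  "inclusion_category enc pair P =
     \<lparr>Obj = enc ` P,
      Mor = {pair (enc U, enc W) | U W. U \<in> P \<and> W \<in> P \<and> U \<subseteq> W},
      Dom = (\<lambda>m. fst (inv pair m)),
      Cod = (\<lambda>m. snd (inv pair m)),
      Ident = (\<lambda>x. pair (x, x)),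
      Comp = (\<lambda>n m. pair (fst (inv pair m), snd (inv pair n)))\<rparr>"

lemma Obj_inclusion_category [simp]: "Obj (inclusion_category enc pair P) = enc ` P"
  by (simp add: inclusion_category_def)

lemma hom_inclusion_category:
  assumes "inj pair"
  shows "m \<in> hom (inclusion_category enc pair P) x y \<longleftrightarrow>
    m = pair (x, y) \<and> (\<exists>U\<in>P. \<exists>W\<in>P. U \<subseteq> W \<and> x = enc U \<and> y = enc W)"
  unfolding hom_def inclusion_category_def using inv_f_f[OF assms] by auto blast

lemma Comp_inclusion_category:
  assumes "inj pair"
  shows "Comp (inclusion_category enc pair P) (pair (y, z)) (pair (x, y)) = pair (x, z)"
  unfolding inclusion_category_def using inv_f_f[OF assms] by simp

lemma Ident_inclusion_category [simp]:
  "Ident (inclusion_category enc pair P) x = pair (x, x)"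
  by (simp add: inclusion_category_def)

lemma inclusion_category_is_category:
  assumes pair: "inj pair" and enc: "inj_on enc P"
  shows "is_category (inclusion_category enc pair P)" (is "is_category ?C")
proof -
  note hom = hom_inclusion_category[OF pair, of _ enc P]
  note comp = Comp_inclusion_category[OF pair, of enc P]
  have mor: "\<forall>m\<in>Mor ?C. Dom ?C m \<in> Obj ?C \<and> Cod ?C m \<in> Obj ?C"
    unfolding inclusion_category_def using inv_f_f[OF pair] by auto
  have trans: "Comp ?C n m \<in> hom ?C x z"
    if xy: "m \<in> hom ?C x y" and yz: "n \<in> hom ?C y z" for m n x y z
  proof -
    obtain U W where m: "m = pair (x, y)" "U \<in> P" "W \<in> P" "U \<subseteq> W" "x = enc U" "y = enc W"
      using xy unfolding hom by blast
    obtain W' Z where n: "n = pair (y, z)" "W' \<in> P" "Z \<in> P" "W' \<subseteq> Z" "y = enc W'" "z = enc Z"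
      using yz unfolding hom by blast
    have "W = W'"
      using inj_onD[OF enc] m n by metis
    then show ?thesis
      unfolding hom m(1) n(1) comp using m n by blast
  qed
  have id: "pair (x, x) \<in> hom ?C x x" if "x \<in> enc ` P" for x
    using that unfolding hom by blast
  show "is_category ?C"
    unfolding is_category_def
  proof (intro conjI mor ballI allI impI)
    show "Ident ?C x \<in> hom ?C x x" if "x \<in> Obj ?C" for x
      using id that by simp
    show "Comp ?C g f \<in> hom ?C X Z" if "f \<in> hom ?C X Y \<and> g \<in> hom ?C Y Z" for X Y Z f g
      using trans that by blast
    show "Comp ?C f (Ident ?C X) = f" if "f \<in> hom ?C X Y" for X Y f
      using that comp unfolding hom by auto
    show "Comp ?C (Ident ?C Y) f = f" if "f \<in> hom ?C X Y" for X Y f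
      using that comp unfolding hom by auto
    show "Comp ?C h (Comp ?C g f) = Comp ?C (Comp ?C h g) f"
      if "f \<in> hom ?C W X \<and> g \<in> hom ?C X Y \<and> h \<in> hom ?C Y Z" for W X Y Z f g h
    proof -
      have "f = pair (W, X)" "g = pair (X, Y)" "h = pair (Y, Z)"
        using that unfolding hom by blast+
      then show ?thesis
        by (simp add: comp)
    qed
  qed
qed

lemma inclusion_category_small:
  assumes V: "set_universe TYPE('v)" and pair: "inj (pair :: 'v \<times> 'v \<Rightarrow> 'v)"
    and enc: "inj_on enc P" and P: "small TYPE('v) P"
  shows "small_category TYPE('v) (inclusion_category enc pair P)" (is "small_category _ ?C")
proof -
  have "Mor ?C \<subseteq> (\<lambda>(U, W). pair (enc U, enc W)) ` (P \<times> P)"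
    unfolding inclusion_category_def by auto
  then have "small TYPE('v) (Mor ?C)"
    using small_Times[OF V P P] small_image small_subset by blast
  then show ?thesis
    unfolding small_category_def
    using inclusion_category_is_category[OF pair enc] P by (simp add: small_image)
qed

text \<open>
  A diagram in a poset has a cocone once its objects have an upper bound; here the union of the
  objects is one, as it is a union of at most \<open>|M|\<close> sets of size at most \<open>|M|\<close>.
\<close>

lemma inclusion_category_filtered:
  fixes M :: "'v set" and A :: "'a set"
  assumes pair: "inj (pair :: 'v \<times> 'v \<Rightarrow> 'v)" and enc: "inj_on enc {U. U \<subseteq> A \<and> |U| \<le>o |M|}"
    and M: "infinite M" and \<kappa>: "\<kappa> \<le>o |M|"
  shows "filtered \<kappa> (inclusion_category enc pair {U. U \<subseteq> A \<and> |U| \<le>o |M| })"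
    (is "filtered _ ?C")
  unfolding filtered_def
proof (intro allI impI, elim conjE)
  let ?P = "{U. U \<subseteq> A \<and> |U| \<le>o |M| }"
  fix I :: "('v, 'v) cat" and D
  assume I: "is_category I" and small: "|Mor I| <o \<kappa>" and D: "is_functor I ?C D"
  define dec where "dec = inv_into ?P enc"
  have dec: "dec (FObj D i) \<in> ?P" "enc (dec (FObj D i)) = FObj D i" if "i \<in> Obj I" for i
    using functor_FObj[OF D that] unfolding dec_def Obj_inclusion_category
    by (rule inv_into_into, rule f_inv_into_f)
  define W where "W = (\<Union>i\<in>Obj I. dec (FObj D i))"
  \<comment> \<open>The identities bound the number of objects by the number of morphisms.\<close>
  have "Ident I ` Obj I \<subseteq> Mor I" "inj_on (Ident I) (Obj I)"
    using ident_in_hom[OF I] unfolding hom_def by (auto intro!: inj_onI) metis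
  then have "|Obj I| \<le>o |Mor I|"
    using card_of_ordLeq by blast
  then have "|Obj I| \<le>o |M|"
    using ordLess_imp_ordLeq[OF small] \<kappa> ordLeq_transitive by blast
  then have "|W| \<le>o |M|"
    unfolding W_def using dec by (intro card_of_UNION_ordLeq_infinite[OF M]) auto
  moreover have "W \<subseteq> A"
    unfolding W_def using dec by blast
  ultimately have W: "W \<in> ?P"
    by simp
  have leg: "pair (FObj D i, enc W) \<in> hom ?C (FObj D i) (enc W)" if "i \<in> Obj I" for i
  proof -
    have "dec (FObj D i) \<subseteq> W"
      unfolding W_def using that by blast
    then show ?thesis
      unfolding hom_inclusion_category[OF pair] using dec[OF that] W
      by (intro conjI bexI[of _ "dec (FObj D i)"] bexI[of _ W]) simp_all
  qed
  have "is_cocone I ?C D (enc W) (\<lambda>i. pair (FObj D i, enc W))"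
    unfolding is_cocone_def
  proof (intro conjI ballI leg)
    show "enc W \<in> Obj ?C"
      using W by simp
    fix i j u assume "u \<in> hom I i j"
    then have "FMor D u = pair (FObj D i, FObj D j)"
      using functor_FMor[OF I D] unfolding hom_inclusion_category[OF pair] by blast
    then show "Comp ?C (pair (FObj D j, enc W)) (FMor D u) = pair (FObj D i, enc W)"
      by (simp add: Comp_inclusion_category[OF pair])
  qed
  then show "\<exists>j c. is_cocone I ?C D j c"
    by blast
qed

text \<open>
  A colimit of \<open>D\<close> may be computed in two stages, first over the members \<open>U\<close> of a covering family
  and then over the family ordered by inclusion. Doubletons in the family suffice for the
  covering: a cocone over the family restricts to components at single objects \<open>i\<close> of \<open>J\<close>, and an
  arrow \<open>i \<rightarrow> j\<close> is seen by the member \<open>{i, j}\<close>.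
\<close>

lemma colimit_of_directed_family:
  assumes K: "is_category K" and J: "is_category J" and D: "is_functor J K D"
    and c: "is_colimit J K D X c"
    and pair: "inj (pair :: 'v \<times> 'v \<Rightarrow> 'v)" and enc: "inj_on enc P"
    and P: "\<And>U. U \<in> P \<Longrightarrow> U \<subseteq> Obj J"
    and doubleton: "\<And>i j. i \<in> Obj J \<Longrightarrow> j \<in> Obj J \<Longrightarrow> {i, j} \<in> P"
    and sub: "\<And>U. U \<in> P \<Longrightarrow> is_colimit (full_subcategory J U) K D (F U) (b U)"
  shows "\<exists>E p. is_functor (inclusion_category enc pair P) K E \<and>
    (\<forall>U\<in>P. FObj E (enc U) = F U) \<and> is_colimit (inclusion_category enc pair P) K E X p"
proof -
  let ?C = "inclusion_category enc pair P"
  note hom = hom_inclusion_category[OF pair, of _ enc P]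
  note comp = Comp_inclusion_category[OF pair, of enc P]
  have cat: "is_category (full_subcategory J U)" if "U \<in> P" for U
    using full_subcategory_is_category[OF J P[OF that]] .
  have func: "is_functor (full_subcategory J U) K D" if "U \<in> P" for U
    using functor_restrict_domain[OF J D P[OF that]] .
  have b: "b U i \<in> hom K (FObj D i) (F U)" if "U \<in> P" "i \<in> U" for U i
    using cocone_leg[OF colimit_cocone[OF sub[OF that(1)]]] that(2) by simp
  have b_natural: "Comp K (b U j) (FMor D u) = b U i"
    if "U \<in> P" "i \<in> U" "j \<in> U" "u \<in> hom J i j" for U i j u
    using cocone_natural[OF cat colimit_cocone[OF sub], OF that(1,1)] that(2-)
    by (simp add: hom_full_subcategory)
  have epi: "f = g"
    if "U \<in> P" "f \<in> hom K (F U) Y" "g \<in> hom K (F U) Y"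
      "\<And>i. i \<in> U \<Longrightarrow> Comp K f (b U i) = Comp K g (b U i)" for U Y f g
    using colimit_jointly_epi[OF cat K func sub, OF that(1,1,1,2,3)] that(4) by simp
  have restrict: "is_cocone (full_subcategory J U) K D Y d"
    if "is_cocone (full_subcategory J W) K D Y d" "U \<subseteq> W" for U W Y d
    using that unfolding is_cocone_def Ball_def hom_full_subcategory Obj_full_subcategory by blast
  have "\<exists>t. t \<in> hom K (F U) (F W) \<and> (\<forall>i\<in>U. Comp K t (b U i) = b W i)"
    if "U \<in> P" "W \<in> P" "U \<subseteq> W" for U W
    using colimit_factor[OF sub[OF that(1)] restrict[OF colimit_cocone[OF sub[OF that(2)]] that(3)]]
    by (metis Obj_full_subcategory)
  then obtain t where t: "t U W \<in> hom K (F U) (F W)"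
      and tb: "i \<in> U \<Longrightarrow> Comp K (t U W) (b U i) = b W i"
    if "U \<in> P" "W \<in> P" "U \<subseteq> W" for U W i
    by metis
  have "is_cocone (full_subcategory J U) K D X c" if "U \<in> P" for U
    using colimit_cocone[OF c] P[OF that]
    unfolding is_cocone_def Ball_def hom_full_subcategory Obj_full_subcategory by blast
  then have "\<exists>q. q \<in> hom K (F U) X \<and> (\<forall>i\<in>U. Comp K q (b U i) = c i)" if "U \<in> P" for U
    using colimit_factor[OF sub[OF that]] that by (metis Obj_full_subcategory)
  then obtain q where q: "q U \<in> hom K (F U) X" and qb: "i \<in> U \<Longrightarrow> Comp K (q U) (b U i) = c i"
    if "U \<in> P" for U i
    by metis
  define dec where "dec = inv_into P enc"
  have dec [simp]: "dec (enc U) = U" if "U \<in> P" for U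
    unfolding dec_def using inv_into_f_f[OF enc that] .
  define E where "E = \<lparr>FObj = \<lambda>x. F (dec x),
    FMor = \<lambda>m. t (dec (fst (inv pair m))) (dec (snd (inv pair m)))\<rparr>"
  have E_Obj [simp]: "FObj E (enc U) = F U" if "U \<in> P" for U
    unfolding E_def using that by simp
  have E_Mor [simp]: "FMor E (pair (enc U, enc W)) = t U W" if "U \<in> P" "W \<in> P" for U W
    unfolding E_def using that by (simp add: inv_f_f[OF pair])
  have arrow: "\<exists>U\<in>P. \<exists>W\<in>P. U \<subseteq> W \<and> x = enc U \<and> y = enc W \<and> m = pair (enc U, enc W)"
    if "m \<in> hom ?C x y" for m x y
    using that unfolding hom by blast
  have E: "is_functor ?C K E"
  proof (rule functorI)
    show "FObj E x \<in> Obj K" if "x \<in> Obj ?C" for x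
      using that hom_objects[OF K q] by auto
    show "FMor E m \<in> hom K (FObj E x) (FObj E y)" if m: "m \<in> hom ?C x y" for x y m
      using arrow[OF m] t by auto
    show "FMor E (Ident ?C x) = Ident K (FObj E x)" if x: "x \<in> Obj ?C" for x
    proof -
      obtain U where U: "U \<in> P" "x = enc U"
        using x by auto
      have "F U \<in> Obj K"
        using hom_objects[OF K q[OF U(1)]] by blast
      moreover have "Comp K (t U U) (b U i) = Comp K (Ident K (F U)) (b U i)" if "i \<in> U" for i
        using tb[OF U(1) U(1) _ that] comp_ident(2)[OF K b[OF U(1) that]] by simp
      ultimately have "t U U = Ident K (F U)"
        using epi[OF U(1) t[OF U(1) U(1)] ident_in_hom[OF K]] by blast
      then show ?thesis
        using U by simp
    qed
    show "FMor E (Comp ?C n m) = Comp K (FMor E n) (FMor E m)"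
      if m: "m \<in> hom ?C x y" and n: "n \<in> hom ?C y z" for x y z m n
    proof -
      obtain U W where U: "U \<in> P" "W \<in> P" "U \<subseteq> W" "y = enc W" "m = pair (enc U, enc W)"
        using arrow[OF m] by blast
      obtain W' Z where Z: "W' \<in> P" "Z \<in> P" "W' \<subseteq> Z" "y = enc W'" "n = pair (enc W', enc Z)"
        using arrow[OF n] by blast
      have W: "W' = W"
        using inj_onD[OF enc] U Z by metis
      have tW: "t U W \<in> hom K (F U) (F W)" and tZ: "t W Z \<in> hom K (F W) (F Z)"
        using t U Z W by blast+
      have "t U Z = Comp K (t W Z) (t U W)"
      proof (rule epi[OF U(1)])
        show "t U Z \<in> hom K (F U) (F Z)"
          using t U Z W by blast
        show "Comp K (t W Z) (t U W) \<in> hom K (F U) (F Z)"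
          using comp_in_hom[OF K tW tZ] .
        fix i assume i: "i \<in> U"
        have "Comp K (Comp K (t W Z) (t U W)) (b U i) = Comp K (t W Z) (b W i)"
          using comp_assoc[OF K b[OF U(1) i] tW tZ] tb[OF U(1-3) i] by simp
        also have "\<dots> = b Z i"
          using tb[of W Z i] U Z W i by blast
        also have "\<dots> = Comp K (t U Z) (b U i)"
          using tb[of U Z i] U Z W i by auto
        finally show "Comp K (t U Z) (b U i) = Comp K (Comp K (t W Z) (t U W)) (b U i)"
          by simp
      qed
      then show ?thesis
        using U Z W by (simp add: comp)
    qed
  qed
  have "is_colimit ?C K E X (\<lambda>x. q (dec x))"
    unfolding is_colimit_def
  proof (intro conjI allI impI)
    have "Comp K (q W) (t U W) = q U" if U: "U \<in> P" "W \<in> P" "U \<subseteq> W" for U W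
    proof (rule epi[OF U(1)])
      show "Comp K (q W) (t U W) \<in> hom K (F U) X"
        using comp_in_hom[OF K t[OF U] q[OF U(2)]] .
      show "Comp K (Comp K (q W) (t U W)) (b U i) = Comp K (q U) (b U i)" if i: "i \<in> U" for i
        using comp_assoc[OF K b[OF U(1) i] t[OF U] q[OF U(2)]] tb[OF U i] qb[OF U(1) i]
          qb[OF U(2)] i U(3) by auto
    qed (rule q[OF U(1)])
    note qt = this
    show "is_cocone ?C K E X (\<lambda>x. q (dec x))"
      unfolding is_cocone_def
    proof (intro conjI ballI)
      show "X \<in> Obj K"
        using cocone_object[OF colimit_cocone[OF c]] .
      show "q (dec x) \<in> hom K (FObj E x) X" if "x \<in> Obj ?C" for x
        using that q by auto
      show "Comp K (q (dec y)) (FMor E m) = q (dec x)" if m: "m \<in> hom ?C x y" for x y m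
      proof -
        obtain U W where "U \<in> P" "W \<in> P" "U \<subseteq> W" "x = enc U" "y = enc W"
            "m = pair (enc U, enc W)"
          using arrow[OF m] by blast
        then show ?thesis
          using qt by simp
      qed
    qed
  next
    fix Y d assume d: "is_cocone ?C K E Y d"
    note C = inclusion_category_is_category[OF pair enc]
    have dU: "d (enc U) \<in> hom K (F U) Y" if "U \<in> P" for U
      using cocone_leg[OF d, of "enc U"] that by simp
    have dt: "Comp K (d (enc W)) (t U W) = d (enc U)" if "U \<in> P" "W \<in> P" "U \<subseteq> W" for U W
    proof -
      have "pair (enc U, enc W) \<in> hom ?C (enc U) (enc W)"
        unfolding hom using that by blast
      then show ?thesis
        using cocone_natural[OF C d] that by fastforce
    qed
    have single: "{i} \<in> P" if "i \<in> Obj J" for i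
      using doubleton[OF that that] by simp
    \<comment> \<open>The component at \<open>i\<close> does not depend on the member of \<open>P\<close> used to read it off.\<close>
    define a where "a i = Comp K (d (enc {i})) (b {i} i)" for i
    have a: "a i = Comp K (d (enc U)) (b U i)" if U: "U \<in> P" and i: "i \<in> U" for U i
    proof -
      have iJ: "i \<in> Obj J" and sub: "{i} \<subseteq> U"
        using P[OF U] i by auto
      note s = single[OF iJ]
      show ?thesis
        unfolding a_def
        using comp_assoc[OF K b[OF s, of i] t[OF s U sub] dU[OF U]] dt[OF s U sub]
          tb[OF s U sub, of i] by simp
    qed
    have "is_cocone J K D Y a"
      unfolding is_cocone_def
    proof (intro conjI ballI)
      show "Y \<in> Obj K"
        using cocone_object[OF d] .
      fix i assume i: "i \<in> Obj J"
      show "a i \<in> hom K (FObj D i) Y"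
        unfolding a_def using comp_in_hom[OF K b dU] single[OF i] by simp
      fix j u assume j: "j \<in> Obj J" and u: "u \<in> hom J i j"
      note ij = doubleton[OF i j]
      show "Comp K (a j) (FMor D u) = a i"
        using comp_assoc[OF K functor_FMor[OF J D u] b[OF ij, of j] dU[OF ij]]
          b_natural[OF ij _ _ u] a[OF ij] by simp
    qed
    then obtain f where f: "f \<in> hom K X Y" and fc: "\<And>i. i \<in> Obj J \<Longrightarrow> Comp K f (c i) = a i"
      using colimit_factor[OF c] by blast
    have fq: "Comp K f (q U) = d (enc U)" if U: "U \<in> P" for U
    proof (rule epi[OF U])
      show "Comp K f (q U) \<in> hom K (F U) Y"
        using comp_in_hom[OF K q[OF U] f] .
      show "Comp K (Comp K f (q U)) (b U i) = Comp K (d (enc U)) (b U i)" if i: "i \<in> U" for i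
        using comp_assoc[OF K b[OF U i] q[OF U] f] qb[OF U i] fc[of i] P[OF U] a[OF U i] i
        by auto
    qed (rule dU[OF U])
    have unique: "g = f"
      if g: "g \<in> hom K X Y" "\<forall>x\<in>Obj ?C. Comp K g (q (dec x)) = d x" for g
    proof (rule colimit_jointly_epi[OF J K D c g(1) f])
      fix i assume i: "i \<in> Obj J"
      note s = single[OF i]
      have "Comp K g (c i) = Comp K (Comp K g (q {i})) (b {i} i)"
        using comp_assoc[OF K b[OF s, of i] q[OF s] g(1)] qb[OF s, of i] by simp
      also have "Comp K g (q {i}) = d (enc {i})"
        using bspec[OF g(2), of "enc {i}"] s by simp
      finally show "Comp K g (c i) = Comp K f (c i)"
        using fc[OF i] a_def by simp
    qed
    show "\<exists>!g. g \<in> hom K X Y \<and> (\<forall>x\<in>Obj ?C. Comp K g (q (dec x)) = d x)"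
    proof (rule ex1I)
      show "f \<in> hom K X Y \<and> (\<forall>x\<in>Obj ?C. Comp K f (q (dec x)) = d x)"
        using f fq by auto
    qed (use unique in blast)
  qed
  then show ?thesis
    using E E_Obj by blast
qed

section \<open>Canonical colimits\<close>

lemma cocone_comma_iff:
  assumes K: "is_category K"
  shows "is_cocone (comma K T X) K (canonical_diagram K) Y d \<longleftrightarrow>
    Y \<in> Obj K \<and> (\<forall>A\<in>T. \<forall>g\<in>hom K A X. d g \<in> hom K A Y) \<and>
    (\<forall>A\<in>T. \<forall>B\<in>T. \<forall>g\<in>hom K B X. \<forall>h\<in>hom K A B. Comp K (d g) h = d (Comp K g h))"
    (is "?L \<longleftrightarrow> ?R")
proof
  assume d: ?L
  show ?R
  proof (intro conjI ballI)
    show "Y \<in> Obj K"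
      using cocone_object[OF d] .
    show "d g \<in> hom K A Y" if "A \<in> T" "g \<in> hom K A X" for A g
      using cocone_leg[OF d, of g] that by (simp add: comma_def canonical_diagram_def hom_def)
    fix A B g h assume *: "A \<in> T" "B \<in> T" "g \<in> hom K B X" "h \<in> hom K A B"
    let ?f = "Comp K g h"
    have f: "?f \<in> hom K A X"
      using comp_in_hom[OF K *(4,3)] .
    have "?f \<in> Obj (comma K T X)" "g \<in> Obj (comma K T X)"
      using * f unfolding comma_def hom_def by auto
    moreover have "(?f, h, g) \<in> hom (comma K T X) ?f g"
      using * f unfolding comma_def hom_def by auto
    ultimately have "Comp K (d g) (FMor (canonical_diagram K) (?f, h, g)) = d ?f"
      using d unfolding is_cocone_def by blast
    then show "Comp K (d g) h = d ?f"
      by (simp add: canonical_diagram_def)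
  qed
next
  assume R: ?R
  show ?L
    unfolding is_cocone_def
  proof (intro conjI ballI)
    show "Y \<in> Obj K"
      using R by blast
    fix g assume "g \<in> Obj (comma K T X)"
    then have g: "g \<in> hom K (Dom K g) X" "Dom K g \<in> T"
      unfolding comma_def hom_def by auto
    then show "d g \<in> hom K (FObj (canonical_diagram K) g) Y"
      using R by (simp add: canonical_diagram_def)
    fix g' u assume "g' \<in> Obj (comma K T X)" and u: "u \<in> hom (comma K T X) g g'"
    then have g': "g' \<in> hom K (Dom K g') X" "Dom K g' \<in> T"
      unfolding comma_def hom_def by auto
    obtain h where h: "u = (g, h, g')" "h \<in> hom K (Dom K g) (Dom K g')" "Comp K g' h = g"
      using u unfolding comma_def hom_def by auto
    then show "Comp K (d g') (FMor (canonical_diagram K) u) = d g"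
      using R g g' by (simp add: canonical_diagram_def)
  qed
qed

lemma generator_cancel:
  assumes gen: "generator K S" and K: "is_category K" and f: "f \<in> hom K X Y" and g: "g \<in> hom K X Y"
    and eq: "\<And>G h. G \<in> S \<Longrightarrow> h \<in> hom K G X \<Longrightarrow> Comp K f h = Comp K g h"
  shows "f = g"
proof -
  have "FMor (hom_functor K G) f = FMor (hom_functor K G) g" if "G \<in> S" for G
    using eq[OF that] unfolding FMor_hom_functor[OF f] FMor_hom_functor[OF g]
    by (auto intro: restrict_ext)
  then show ?thesis
    using gen f g hom_objects[OF K f] unfolding generator_def by blast
qed

text \<open>
  A criterion for \<open>X\<close> to be the canonical colimit of objects of \<open>T\<close>: the given colimit yields the
  factorizing morphism and its uniqueness. That this morphism is also compatible with the
  morphisms \<open>g : A \<rightarrow> X\<close> that are not legs is checked on the generator, where \<open>g\<close> is compared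
  with a leg through a commutative square whose corner lies in \<open>S \<subseteq> T\<close>.
\<close>

lemma canonical_colimit_if_generator_factors:
  assumes K: "is_category K" and gen: "generator K S" and ST: "S \<subseteq> T"
    and J: "is_category J" and D: "is_functor J K D" and DT: "\<And>i. i \<in> Obj J \<Longrightarrow> FObj D i \<in> T"
    and c: "is_colimit J K D X c"
    and factor: "\<And>G h. G \<in> S \<Longrightarrow> h \<in> hom K G X \<Longrightarrow>
      \<exists>i\<in>Obj J. \<exists>k\<in>hom K G (FObj D i). Comp K (c i) k = h"
  shows "is_colimit (comma K T X) K (canonical_diagram K) X (\<lambda>g. g)"
  unfolding is_colimit_def
proof (intro conjI allI impI)
  note cX = colimit_cocone[OF c]
  show "is_cocone (comma K T X) K (canonical_diagram K) X (\<lambda>g. g)"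
    unfolding cocone_comma_iff[OF K] using cocone_object[OF cX] by blast
  fix Y d assume "is_cocone (comma K T X) K (canonical_diagram K) Y d"
  then have Y: "Y \<in> Obj K" and d: "\<And>A g. A \<in> T \<Longrightarrow> g \<in> hom K A X \<Longrightarrow> d g \<in> hom K A Y"
    and dh: "\<And>A B g h. A \<in> T \<Longrightarrow> B \<in> T \<Longrightarrow> g \<in> hom K B X \<Longrightarrow> h \<in> hom K A B \<Longrightarrow>
      Comp K (d g) h = d (Comp K g h)"
    unfolding cocone_comma_iff[OF K] by blast+
  have "is_cocone J K D Y (\<lambda>i. d (c i))"
    unfolding is_cocone_def
  proof (intro conjI ballI Y)
    fix i assume i: "i \<in> Obj J"
    show "d (c i) \<in> hom K (FObj D i) Y"
      using d[OF DT[OF i] cocone_leg[OF cX i]] .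
    fix j u assume j: "j \<in> Obj J" and u: "u \<in> hom J i j"
    show "Comp K (d (c j)) (FMor D u) = d (c i)"
      using dh[OF DT[OF i] DT[OF j] cocone_leg[OF cX j] functor_FMor[OF J D u]]
        cocone_natural[OF J cX u] by simp
  qed
  then obtain f where f: "f \<in> hom K X Y" and fc: "\<And>i. i \<in> Obj J \<Longrightarrow> Comp K f (c i) = d (c i)"
    using colimit_factor[OF c] by blast
  \<comment> \<open>The square \<open>c i\<close> after \<open>k\<close> = \<open>g\<close> after \<open>h\<close> carries the values of \<open>d\<close> from the legs to \<open>g\<close>.\<close>
  have fg: "Comp K f g = d g" if A: "A \<in> T" and g: "g \<in> hom K A X" for A g
  proof (rule generator_cancel[OF gen K comp_in_hom[OF K g f] d[OF A g]])
    fix G h assume G: "G \<in> S" and h: "h \<in> hom K G A"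
    have GT: "G \<in> T"
      using G ST by blast
    obtain i k where i: "i \<in> Obj J" and k: "k \<in> hom K G (FObj D i)"
      and gh: "Comp K (c i) k = Comp K g h"
      using factor[OF G comp_in_hom[OF K h g]] by blast
    have "Comp K (Comp K f g) h = Comp K f (Comp K (c i) k)"
      using comp_assoc[OF K h g f] gh by simp
    also have "\<dots> = Comp K (d (c i)) k"
      using comp_assoc[OF K k cocone_leg[OF cX i] f] fc[OF i] by simp
    also have "\<dots> = d (Comp K g h)"
      using dh[OF GT DT[OF i] cocone_leg[OF cX i] k] gh by simp
    also have "\<dots> = Comp K (d g) h"
      using dh[OF GT A g h] by simp
    finally show "Comp K (Comp K f g) h = Comp K (d g) h" .
  qed
  show "\<exists>!u. u \<in> hom K X Y \<and> (\<forall>g\<in>Obj (comma K T X). Comp K u g = d g)"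
  proof (rule ex1I)
    show "f \<in> hom K X Y \<and> (\<forall>g\<in>Obj (comma K T X). Comp K f g = d g)"
      using f fg homI by (fastforce simp: comma_def)
    fix u assume u: "u \<in> hom K X Y \<and> (\<forall>g\<in>Obj (comma K T X). Comp K u g = d g)"
    have "Comp K u (c i) = Comp K f (c i)" if i: "i \<in> Obj J" for i
    proof -
      have "c i \<in> Obj (comma K T X)"
        using cocone_leg[OF cX i] DT[OF i] unfolding comma_def hom_def by simp
      then show ?thesis
        using u fc[OF i] by simp
    qed
    then show "u = f"
      using colimit_jointly_epi[OF J K D c _ f] u by blast
  qed
qed

section \<open>The dense subcategory\<close>

lemma small_objects_small_Mor:
  assumes V: "set_universe TYPE('v)" and K: "is_category K" and ls: "locally_small TYPE('v) K"
    and S: "S \<subseteq> Obj K" "small TYPE('v) S"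
  shows "small TYPE('v) (Mor (full_subcategory K S))"
proof -
  have "Mor (full_subcategory K S) \<subseteq> (\<Union>A\<in>S. \<Union>B\<in>S. hom K A B)"
    unfolding full_subcategory_def hom_def by auto
  moreover have "small TYPE('v) (\<Union>A\<in>S. \<Union>B\<in>S. hom K A B)"
    using ls S unfolding locally_small_def by (intro small_UN[OF V]) auto
  ultimately show ?thesis
    using small_subset by blast
qed

text \<open>
  The family consists of all sets of at most \<open>|M|\<close> objects of \<open>J\<close>. The full subcategories on these
  sets may have more than \<open>|M|\<close> morphisms, but the codes of the restricted diagrams still lie in
  \<open>M \<times> N \<times> M\<close>, so it is enough to bound the number of objects.
\<close>

lemma directed_family_of_representatives:
  fixes K :: "('v, 'v) cat" and M :: "'v set"
  assumes V: "set_universe TYPE('v)" and K: "is_category K" and coc: "cocomplete K"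
    and M: "infinite M" and N: "N = Mor (full_subcategory K S)" and S: "S \<subseteq> Obj K"
    and J: "small_category TYPE('v) (J :: ('v, 'v) cat)"
    and D: "is_functor J (full_subcategory K S) D" and c: "is_colimit J K D X c"
  shows "\<exists>(C :: ('v, 'v) cat) E p. small_category TYPE('v) C \<and> is_functor C K E \<and>
    (\<forall>\<kappa>. \<kappa> \<le>o |M| \<longrightarrow> filtered \<kappa> C) \<and> is_colimit C K E X p \<and>
    (\<forall>x\<in>Obj C. FObj E x \<in> Obj K \<inter> colimit_of_code K ` Pow (M \<times> N \<times> M))"
proof -
  have J': "is_category J"
    using J unfolding small_category_def by blast
  have DK: "is_functor J K D"
    using functor_into_full_subcategory[OF J' D S] .
  let ?P = "{U. U \<subseteq> Obj J \<and> |U| \<le>o |M| }"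
  have "|UNIV \<times> UNIV :: ('v \<times> 'v) set| \<le>o |UNIV :: 'v set|"
    using card_of_Times_same_infinite[OF set_universe_infinite[OF V]] ordIso_iff_ordLeq by blast
  then obtain pair :: "'v \<times> 'v \<Rightarrow> 'v" where pair: "inj pair"
    unfolding card_of_ordLeq[symmetric] by auto
  have "small TYPE('v) (Pow (Obj J))"
    using small_Pow[OF V] J unfolding small_category_def by blast
  then have P: "small TYPE('v) ?P"
    by (rule small_subset) auto
  then obtain enc :: "'v set \<Rightarrow> 'v" where enc: "inj_on enc ?P"
    by (rule small_imp_inj_on)
  have "\<exists>A b. A \<in> colimit_of_code K ` Pow (M \<times> N \<times> M) \<and>
      is_colimit (full_subcategory J U) K D A b" if U: "U \<in> ?P" for U
  proof -
    let ?J = "full_subcategory J U"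
    obtain e :: "'v \<Rightarrow> 'v" where e: "inj_on e U" "e ` U \<subseteq> M"
      using U card_of_ordLeq[of U M] by auto
    have JU: "is_category ?J" and DU: "is_functor ?J K D"
      using U full_subcategory_is_category[OF J'] functor_restrict_domain[OF J' DK] by blast+
    have "small_category TYPE('v) ?J"
      using small_full_subcategory[OF J] U by blast
    then obtain A b where b: "is_colimit ?J K D A b"
      using coc DU unfolding cocomplete_def by blast
    have "FMor D u \<in> N" if "u \<in> hom J i j" for i j u
      using functor_FMor[OF J' D that] unfolding N by (simp add: hom_def)
    then have "diagram_code ?J D e \<in> Pow (M \<times> N \<times> M)"
      using e(2) unfolding diagram_code_def hom_full_subcategory by auto
    moreover have "\<exists>b. is_colimit ?J K D (colimit_of_code K (diagram_code ?J D e)) b"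
      using colimit_of_code[OF K JU DU _ b] e(1) by simp
    ultimately show ?thesis
      by blast
  qed
  then have "\<forall>U\<in>?P. \<exists>A. A \<in> colimit_of_code K ` Pow (M \<times> N \<times> M) \<and>
      (\<exists>b. is_colimit (full_subcategory J U) K D A b)"
    by blast
  from bchoice[OF this] obtain F
    where F: "\<And>U. U \<in> ?P \<Longrightarrow> F U \<in> colimit_of_code K ` Pow (M \<times> N \<times> M)"
      and Fb: "\<forall>U\<in>?P. \<exists>b. is_colimit (full_subcategory J U) K D (F U) b"
    by blast
  from bchoice[OF Fb] obtain b
    where b: "\<And>U. U \<in> ?P \<Longrightarrow> is_colimit (full_subcategory J U) K D (F U) (b U)"
    by blast
  have doubleton: "{i, j} \<in> ?P" if "i \<in> Obj J" "j \<in> Obj J" for i j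
  proof -
    have "|{i, j}| <o |M|"
      using M by (intro finite_ordLess_infinite[OF card_of_Well_order card_of_Well_order])
        (simp_all add: Field_card_of)
    then show ?thesis
      using that ordLess_imp_ordLeq by blast
  qed
  let ?C = "inclusion_category enc pair ?P"
  obtain E p where E: "is_functor ?C K E" and EF: "\<forall>U\<in>?P. FObj E (enc U) = F U"
      and p: "is_colimit ?C K E X p"
    using colimit_of_directed_family[OF K J' DK c pair enc _ doubleton b] by blast
  have "FObj E x \<in> Obj K \<inter> colimit_of_code K ` Pow (M \<times> N \<times> M)" if "x \<in> Obj ?C" for x
    using functor_FObj[OF E that] that EF F by auto
  then show ?thesis
    using inclusion_category_small[OF V pair enc P] inclusion_category_filtered[OF pair enc M] E p
    by blast
qed

theorem theorem1p1:
  fixes K :: "('v, 'v) cat"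
  assumes "set_universe TYPE('v)"
    and "Vopenka_Principle TYPE('v)"
    and "is_category K"
    and "locally_small TYPE('v) K"
    and "cocomplete K"
    and "\<exists>S. colimit_dense_subcategory K S"
    and "\<exists>S. presentable_generator K S"
  shows "bounded_category K"
proof -
  note V = assms(1) and K = assms(3) and ls = assms(4)
  obtain S where S: "S \<subseteq> Obj K" "small TYPE('v) S"
    and S_colim: "\<And>X. X \<in> Obj K \<Longrightarrow> \<exists>(J :: ('v, 'v) cat) D c.
      small_category TYPE('v) J \<and> is_functor J (full_subcategory K S) D \<and> is_colimit J K D X c"
    using assms(6) unfolding colimit_dense_subcategory_def by blast
  obtain G where gen: "generator K G" and pres: "\<forall>A\<in>G. presentable K A"
    using assms(7) unfolding presentable_generator_def by blast
  have G: "G \<subseteq> Obj K" "small TYPE('v) G"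
    using gen unfolding generator_def by blast+
  obtain \<kappa> where \<kappa>: "\<And>A. A \<in> G \<Longrightarrow> regular_cardinal (\<kappa> A)"
    and \<kappa>_pres: "\<And>A. A \<in> G \<Longrightarrow> preserves_filtered_colimits (\<kappa> A) K Set_cat (hom_functor K A)"
    using pres unfolding presentable_def by metis
  obtain M :: "'v set" where M: "infinite M" "small TYPE('v) M"
    and \<kappa>M: "\<And>A. A \<in> G \<Longrightarrow> \<kappa> A \<le>o |M|"
    using common_bound_of_cardinals[of G \<kappa>, OF V G(2) \<kappa>] by blast
  define N where "N = Mor (full_subcategory K S)"
  \<comment> \<open>A set that is not the code of a diagram with a colimit contributes an arbitrary choice, which
    the intersection restricts to objects of \<open>K\<close>.\<close>
  define R where "R = Obj K \<inter> colimit_of_code K ` Pow (M \<times> N \<times> M)"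
  have "small TYPE('v) N"
    unfolding N_def using small_objects_small_Mor[OF V K ls S] .
  then have "small TYPE('v) (colimit_of_code K ` Pow (M \<times> N \<times> M))"
    by (intro small_image small_Pow[OF V] small_Times[OF V] M(2))
  then have "small TYPE('v) R"
    unfolding R_def by (rule small_subset) blast
  then have small: "small TYPE('v) (G \<union> R)"
    using small_Un[OF V G(2)] by blast
  have "is_colimit (comma K (G \<union> R) X) K (canonical_diagram K) X (\<lambda>g. g)" if X: "X \<in> Obj K" for X
  proof -
    obtain J :: "('v, 'v) cat" and D c where J: "small_category TYPE('v) J"
      "is_functor J (full_subcategory K S) D" "is_colimit J K D X c"
      using S_colim[OF X] by blast
    obtain C :: "('v, 'v) cat" and E p where C: "small_category TYPE('v) C"
      and E: "is_functor C K E" and filt: "\<forall>\<kappa>. \<kappa> \<le>o |M| \<longrightarrow> filtered \<kappa> C"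
      and p: "is_colimit C K E X p" and ER: "\<forall>x\<in>Obj C. FObj E x \<in> R"
      using directed_family_of_representatives[OF V K assms(5) M(1) N_def S(1) J]
      unfolding R_def by blast
    have C': "is_category C"
      using C unfolding small_category_def by blast
    show ?thesis
    proof (rule canonical_colimit_if_generator_factors[OF K gen _ C' E _ p])
      show "\<exists>i\<in>Obj C. \<exists>k\<in>hom K A (FObj E i). Comp K (p i) k = h"
        if A: "A \<in> G" and h: "h \<in> hom K A X" for A h
        using presentable_factorization[OF V K ls \<kappa>_pres[OF A] C _ E p h] filt \<kappa>M[OF A] by blast
    qed (use ER in auto)
  qed
  moreover have "G \<union> R \<subseteq> Obj K"
    using G(1) unfolding R_def by simp
  ultimately have "dense_subcategory K (G \<union> R)"
    unfolding dense_subcategory_def using small by simp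
  then show ?thesis
    unfolding bounded_category_def ..
qed

end
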